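(* Let $(\mathcal{L}_{QA}^{PC},\models)$ be the propositional closure of a qualitative algebra, let $\Omega$ be its set of consistent scenarios, let $d$ be a distance function on $\Omega$, and let $\circ^{d}$ be the associated revision operator. Let $\psi,\mu\in\mathcal{L}_{QA}^{PC}$ and let $\{\psi_i\}_i$ and $\{\mu_j\}_j$ be two finite (nonempty) families of formulas of $\mathcal{L}_{QA}^{PC}$ such that $\psi=\bigvee_i\psi_i$ and $\mu=\bigvee_j\mu_j$. Let $\Delta_{ij}=d(\mathrm{Mod}(\psi_i),\mathrm{Mod}(\mu_j))$ for all $i,j$, and let $\Delta=d(\mathrm{Mod}(\psi),\mathrm{Mod}(\mu))$. Then $$\psi\circ^{d}\mu\;\equiv\;\bigvee_{i,j,\ \Delta_{ij}=\Delta}\psi_i\circ^{d}\mu_j .$$ Moreover, $\Delta=\min_{i,j}\Delta_{ij}$.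
   Context: Qualitative algebra (QA), syntax. $\mathcal{B}$ is a finite set of symbols with $|\mathcal{B}|\ge 2$, called base relations. A relation is an expression $r_1\,|\,\cdots\,|\,r_m$ ($m\ge 0$) of pairwise distinct base relations, order irrelevant (so a relation amounts to a subset of $\mathcal{B}$, possibly empty). $\mathcal{V}$ is a finite nonempty set of variables, disjoint from $\mathcal{B}$. A constraint is an expression $x\,r\,y$ with $x,y\in\mathcal{V}$ and $r$ a relation. A formula of $\mathcal{L}_{QA}$ is a conjunction of $n\ge 1$ constraints. A scenario is a formula which, for every ordered pair of distinct variables $x\ne y$, contains exactly one constraint $x\,r\,y$, with $r$ a base relation, and which has no other constraints; scenarios are identified up to the order of conjuncts. Semantics. A set $\mathcal{U}$ of subsets of some domain is fixed, and each base relation is interpreted as a binary relation on $\mathcal{U}$. The interpretations of the base relations are pairwise disjoint, their union is $\mathcal{U}\times\mathcal{U}$, and the converse of each base relation is a base relation. An interpretation $\mathcal{I}$ maps each variable to an element of $\mathcal{U}$. It satisfies $x\,(r_1\,|\,\cdots\,|\,r_m)\,y$ iff $(\mathcal{I}(x),\mathcal{I}(y))$ belongs to the interpretation of $r_k$ for some $k\in\{1,\dots,m\}$ (so never if $m=0$), and it satisfies a formula iff it satisfies all its constraints. A formula is consistent if some interpretation satisfies it. For $\varphi_1,\varphi_2\in\mathcal{L}_{QA}$, $\varphi_1\models\varphi_2$ means every interpretation satisfying $\varphi_1$ satisfies $\varphi_2$. $\Omega$ is the (finite) set of consistent scenarios, and for $\varphi\in\mathcal{L}_{QA}$, $\mathrm{Mod}(\varphi)=\{\sigma\in\Omega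 \mid \sigma\models\varphi\}$. Propositional closure. $\mathcal{L}_{QA}^{PC}$ is the smallest superset of $\mathcal{L}_{QA}$ closed under $\lnot$ and $\land$; $\varphi_1\lor\varphi_2$ abbreviates $\lnot(\lnot\varphi_1\land\lnot\varphi_2)$. $\mathrm{Mod}$ is extended by $\mathrm{Mod}(\varphi_1\land\varphi_2)=\mathrm{Mod}(\varphi_1)\cap\mathrm{Mod}(\varphi_2)$ and $\mathrm{Mod}(\lnot\varphi)=\Omega\setminus\mathrm{Mod}(\varphi)$. On $\mathcal{L}_{QA}^{PC}$, $\varphi_1\models\varphi_2$ means $\mathrm{Mod}(\varphi_1)\subseteq\mathrm{Mod}(\varphi_2)$, and $\varphi_1\equiv\varphi_2$ means $\mathrm{Mod}(\varphi_1)=\mathrm{Mod}(\varphi_2)$. Every subset of $\Omega$ is of the form $\mathrm{Mod}(\varphi)$ for some $\varphi\in\mathcal{L}_{QA}^{PC}$. Distance and revision. $d:\Omega\times\Omega\to[0,+\infty)$ is a distance function (metric) on $\Omega$. For $A,B\subseteq\Omega$ and $\omega\in\Omega$, $d(A,\omega)=\min_{\alpha\in A}d(\alpha,\omega)$ and $d(A,B)=\min_{\alpha\in A,\beta\in B}d(\alpha,\beta)$, with the convention that the minimum over an empty set is $+\infty$. The revision $\psi\circ^{d}\mu$ of $\psi$ by $\mu$ is the formula of $\mathcal{L}_{QA}^{PC}$, unique up to equivalence, such that $$\mathrm{Mod}(\psi\circ^{d}\mu)=\{\omega\in\mathrm{Mod}(\mu)\mid d(\mathrm{Mod}(\psi),\omega)=\Delta\},\qquad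 \Delta=d(\mathrm{Mod}(\psi),\mathrm{Mod}(\mu)).$$ *)

theory Defs
  imports "HOL-Analysis.Analysis" "HOL-Library.Multiset" "HOL-Library.Extended_Real"
begin

section \<open>Syntax of a qualitative algebra\<close>

text \<open>
  Variables and base relations are the elements of two finite types \<open>'v\<close> and \<open>'b\<close>. The relation
  \<open>r\<^sub>1 | \<dots> | r\<^sub>m\<close> is the set \<open>{r\<^sub>1, \<dots>, r\<^sub>m}\<close> of base relations, and a base relation \<open>b\<close> occurring in a
  constraint is the singleton \<open>{b}\<close>. The triple \<open>(x, r, y)\<close> is the constraint \<open>x r y\<close>.
\<close>

type_synonym ('v, 'b) constraint = "'v \<times> 'b set \<times> 'v"

text \<open>
  A conjunction of constraints is kept up to the order of its conjuncts, hence as a multiset.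
\<close>

type_synonym ('v, 'b) qa_formula = "('v, 'b) constraint multiset"

definition L_QA :: "('v, 'b) qa_formula set" where
  "L_QA = {\<phi>. \<phi> \<noteq> {#}}"

definition scenario :: "('v, 'b) qa_formula \<Rightarrow> bool" where
  "scenario \<sigma> \<longleftrightarrow> \<sigma> \<in> L_QA
     \<and> (\<forall>x y. x \<noteq> y \<longrightarrow> (\<exists>b. {#c \<in># \<sigma>. fst c = x \<and> snd (snd c) = y#} = {#(x, {b}, y)#}))
     \<and> (\<forall>(x, r, y) \<in># \<sigma>. x \<noteq> y)"

section \<open>Semantics\<close>

locale qualitative_algebra =
  fixes U :: "'d set set"
    and R :: "'b::finite \<Rightarrow> 'd set rel"
  assumes two_base_relations: "CARD('b) \<ge> 2"
    and disjoint: "b \<noteq> b' \<Longrightarrow> R b \<inter> R b' = {}"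
    and exhaustive: "(\<Union>b. R b) = U \<times> U"
    and converse_base: "\<exists>b'. R b' = (R b)\<inverse>"

definition interpretations :: "'d set set \<Rightarrow> ('v \<Rightarrow> 'd set) set" where
  "interpretations U = {I. \<forall>x. I x \<in> U}"

definition satisfies_constraint ::
    "('b \<Rightarrow> 'd set rel) \<Rightarrow> ('v \<Rightarrow> 'd set) \<Rightarrow> ('v, 'b) constraint \<Rightarrow> bool" where
  "satisfies_constraint R I = (\<lambda>(x, r, y). \<exists>b\<in>r. (I x, I y) \<in> R b)"

definition satisfies ::
    "('b \<Rightarrow> 'd set rel) \<Rightarrow> ('v \<Rightarrow> 'd set) \<Rightarrow> ('v, 'b) qa_formula \<Rightarrow> bool" where
  "satisfies R I \<phi> \<longleftrightarrow> (\<forall>c \<in># \<phi>. satisfies_constraint R I c)"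

definition consistent ::
    "'d set set \<Rightarrow> ('b \<Rightarrow> 'd set rel) \<Rightarrow> ('v, 'b) qa_formula \<Rightarrow> bool" where
  "consistent U R \<phi> \<longleftrightarrow> (\<exists>I \<in> interpretations U. satisfies R I \<phi>)"

definition qa_entails ::
    "'d set set \<Rightarrow> ('b \<Rightarrow> 'd set rel) \<Rightarrow> ('v, 'b) qa_formula \<Rightarrow> ('v, 'b) qa_formula \<Rightarrow> bool" where
  "qa_entails U R \<phi>\<^sub>1 \<phi>\<^sub>2 \<longleftrightarrow>
     (\<forall>I \<in> interpretations U. satisfies R I \<phi>\<^sub>1 \<longrightarrow> satisfies R I \<phi>\<^sub>2)"

definition Omega :: "'d set set \<Rightarrow> ('b \<Rightarrow> 'd set rel) \<Rightarrow> ('v, 'b) qa_formula set" where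
  "Omega U R = {\<sigma>. scenario \<sigma> \<and> consistent U R \<sigma>}"

section \<open>Propositional closure\<close>

datatype ('v, 'b) pc_formula =
    QA "('v, 'b) qa_formula"
  | Neg "('v, 'b) pc_formula"
  | Conj "('v, 'b) pc_formula" "('v, 'b) pc_formula"

inductive_set L_PC :: "('v, 'b) pc_formula set" where
  QA: "\<phi> \<in> L_QA \<Longrightarrow> QA \<phi> \<in> L_PC"
| Neg: "\<phi> \<in> L_PC \<Longrightarrow> Neg \<phi> \<in> L_PC"
| Conj: "\<phi>\<^sub>1 \<in> L_PC \<Longrightarrow> \<phi>\<^sub>2 \<in> L_PC \<Longrightarrow> Conj \<phi>\<^sub>1 \<phi>\<^sub>2 \<in> L_PC"

definition Disj :: "('v, 'b) pc_formula \<Rightarrow> ('v, 'b) pc_formula \<Rightarrow> ('v, 'b) pc_formula" where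
  "Disj \<phi>\<^sub>1 \<phi>\<^sub>2 = Neg (Conj (Neg \<phi>\<^sub>1) (Neg \<phi>\<^sub>2))"

text \<open>
  The disjunction of a finite sequence of formulas. The empty disjunction is an unsatisfiable
  constraint, with the empty relation; the choice of its variables is immaterial.
\<close>

fun Disjs :: "('v, 'b) pc_formula list \<Rightarrow> ('v, 'b) pc_formula" where
  "Disjs [] = QA {#(undefined, {}, undefined)#}"
| "Disjs [\<phi>] = \<phi>"
| "Disjs (\<phi> # \<phi>' # \<phi>s) = Disj \<phi> (Disjs (\<phi>' # \<phi>s))"

primrec Mod ::
    "'d set set \<Rightarrow> ('b \<Rightarrow> 'd set rel) \<Rightarrow> ('v, 'b) pc_formula \<Rightarrow> ('v, 'b) qa_formula set" where
  "Mod U R (QA \<phi>) = {\<sigma> \<in> Omega U R. qa_entails U R \<sigma> \<phi>}"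
| "Mod U R (Neg \<phi>) = Omega U R - Mod U R \<phi>"
| "Mod U R (Conj \<phi>\<^sub>1 \<phi>\<^sub>2) = Mod U R \<phi>\<^sub>1 \<inter> Mod U R \<phi>\<^sub>2"

definition pc_equiv ::
    "'d set set \<Rightarrow> ('b \<Rightarrow> 'd set rel) \<Rightarrow> ('v, 'b) pc_formula \<Rightarrow> ('v, 'b) pc_formula \<Rightarrow> bool" where
  "pc_equiv U R \<phi>\<^sub>1 \<phi>\<^sub>2 \<longleftrightarrow> Mod U R \<phi>\<^sub>1 = Mod U R \<phi>\<^sub>2"

section \<open>Distance and revision\<close>

definition min_dist :: "ereal set \<Rightarrow> ereal" where
  "min_dist S = (if S = {} then \<infinity> else Min S)"

definition point_dist :: "('a \<Rightarrow> 'a \<Rightarrow> real) \<Rightarrow> 'a set \<Rightarrow> 'a \<Rightarrow> ereal" where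
  "point_dist d A \<omega> = min_dist {ereal (d \<alpha> \<omega>) | \<alpha>. \<alpha> \<in> A}"

definition set_dist :: "('a \<Rightarrow> 'a \<Rightarrow> real) \<Rightarrow> 'a set \<Rightarrow> 'a set \<Rightarrow> ereal" where
  "set_dist d A B = min_dist {ereal (d \<alpha> \<beta>) | \<alpha> \<beta>. \<alpha> \<in> A \<and> \<beta> \<in> B}"

text \<open>
  The revision operator is determined only up to equivalence; a representative is chosen, which
  exists by \<open>Mod_revise\<close> below.
\<close>

definition revise ::
    "'d set set \<Rightarrow> ('b \<Rightarrow> 'd set rel)
     \<Rightarrow> (('v, 'b) qa_formula \<Rightarrow> ('v, 'b) qa_formula \<Rightarrow> real)
     \<Rightarrow> ('v, 'b) pc_formula \<Rightarrow> ('v, 'b) pc_formula \<Rightarrow> ('v, 'b) pc_formula" where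
  "revise U R d \<psi> \<mu> = (SOME \<phi>. \<phi> \<in> L_PC \<and>
     Mod U R \<phi> = {\<omega> \<in> Mod U R \<mu>.
       point_dist d (Mod U R \<psi>) \<omega> = set_dist d (Mod U R \<psi>) (Mod U R \<mu>)})"

lemma Mod_subset_Omega: "Mod U R \<phi> \<subseteq> Omega U R"
  by (induction \<phi>) auto

lemma scenario_count_le_1:
  assumes "scenario \<sigma>"
  shows "count \<sigma> c \<le> 1"
proof -
  obtain x r y where c: "c = (x, r, y)" by (cases c)
  show ?thesis
  proof (cases "x = y")
    case True
    then have "c \<notin># \<sigma>" using assms c by (auto simp: scenario_def)
    then show ?thesis by (simp add: not_in_iff)
  next
    case False
    then obtain b where b: "{#c \<in># \<sigma>. fst c = x \<and> snd (snd c) = y#} = {#(x, {b}, y)#}"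
      using assms unfolding scenario_def by blast
    have "count \<sigma> c = count {#c \<in># \<sigma>. fst c = x \<and> snd (snd c) = y#} c" by (simp add: c)
    then show ?thesis unfolding b by simp
  qed
qed

lemma finite_Omega: "finite (Omega U R :: ('v::finite, 'b::finite) qa_formula set)"
proof -
  have "\<sigma> = mset_set (set_mset \<sigma>)" if "scenario \<sigma>" for \<sigma> :: "('v, 'b) qa_formula"
  proof (rule multiset_eqI)
    fix c
    show "count \<sigma> c = count (mset_set (set_mset \<sigma>)) c"
    proof (cases "c \<in># \<sigma>")
      case True
      then have "count \<sigma> c = 1"
        using scenario_count_le_1[OF that, of c] by (simp add: le_antisym Suc_le_eq)
      then show ?thesis using True by simp
    next
      case False
      then show ?thesis by (simp add: not_in_iff)
    qed
  qed
  then have "(Omega U R :: ('v, 'b) qa_formula set) \<subseteq> mset_set ` UNIV"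
    unfolding Omega_def by blast
  then show ?thesis by (rule finite_subset) simp
qed

lemma Omega_entails_imp_eq:
  fixes \<sigma> \<tau> :: "('v, 'b::finite) qa_formula"
  assumes "qualitative_algebra U R" "\<sigma> \<in> Omega U R" "\<tau> \<in> Omega U R" "qa_entails U R \<sigma> \<tau>"
  shows "\<sigma> = \<tau>"
proof (rule multiset_eqI)
  interpret qualitative_algebra U R by fact
  obtain I where I: "satisfies R I \<sigma>" "satisfies R I \<tau>"
    using assms by (auto simp: Omega_def consistent_def qa_entails_def)
  have sc: "scenario \<sigma>" "scenario \<tau>" using assms by (auto simp: Omega_def)
  fix c :: "('v, 'b) constraint"
  obtain x r y where c: "c = (x, r, y)" by (cases c)
  show "count \<sigma> c = count \<tau> c"
  proof (cases "x = y")
    case True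
    then have "c \<notin># \<sigma>" "c \<notin># \<tau>" using sc c by (auto simp: scenario_def)
    then show ?thesis by (simp add: not_in_iff)
  next
    case False
    let ?P = "\<lambda>\<phi>. {#c \<in># \<phi>. fst c = x \<and> snd (snd c) = y#}"
    obtain b where b: "?P \<sigma> = {#(x, {b}, y)#}" using False sc(1) unfolding scenario_def by blast
    obtain b' where b': "?P \<tau> = {#(x, {b'}, y)#}" using False sc(2) unfolding scenario_def by blast
    have "(x, {b}, y) \<in># ?P \<sigma>" "(x, {b'}, y) \<in># ?P \<tau>" unfolding b b' by simp_all
    then have "(x, {b}, y) \<in># \<sigma>" "(x, {b'}, y) \<in># \<tau>" by simp_all
    then have "(I x, I y) \<in> R b" "(I x, I y) \<in> R b'"
      using I by (auto simp: satisfies_def satisfies_constraint_def)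
    then have "b = b'" using disjoint[of b b'] by blast
    then have "?P \<sigma> = ?P \<tau>" unfolding b b' by simp
    then have "count (?P \<sigma>) c = count (?P \<tau>) c" by simp
    then show ?thesis by (simp add: c)
  qed
qed

lemma ex_Mod_eq:
  fixes A :: "('v::finite, 'b::finite) qa_formula set"
  assumes "qualitative_algebra U R" "A \<subseteq> Omega U R"
  shows "\<exists>\<phi>\<in>L_PC. Mod U R \<phi> = A"
proof -
  have "finite A" using assms(2) finite_Omega by (rule finite_subset)
  then show ?thesis using assms(2)
  proof (induction A rule: finite_induct)
    case empty
    let ?c = "QA {#(undefined, {}, undefined)#} :: ('v, 'b) pc_formula"
    have "Conj ?c (Neg ?c) \<in> L_PC"
      by (intro L_PC.intros) (auto simp: L_QA_def)
    moreover have "Mod U R (Conj ?c (Neg ?c)) = {}" by auto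
    ultimately show ?case by blast
  next
    case (insert \<sigma> A)
    then obtain \<phi> where \<phi>: "\<phi> \<in> L_PC" "Mod U R \<phi> = A" by auto
    have \<sigma>: "\<sigma> \<in> Omega U R" using insert.prems by simp
    then have "\<sigma> \<in> L_QA" by (simp add: Omega_def scenario_def)
    then have "Disj (QA \<sigma>) \<phi> \<in> L_PC" unfolding Disj_def using \<phi> by (intro L_PC.intros)
    moreover have "Mod U R (QA \<sigma>) = {\<sigma>}"
    proof (intro equalityI subsetI)
      fix \<tau> assume "\<tau> \<in> Mod U R (QA \<sigma>)"
      then have "\<tau> \<in> Omega U R" "qa_entails U R \<tau> \<sigma>" by simp_all
      then show "\<tau> \<in> {\<sigma>}" using Omega_entails_imp_eq[OF assms(1) _ \<sigma>] by simp
    qed (use \<sigma> in \<open>simp add: qa_entails_def\<close>)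
    moreover have "Mod U R (Disj (QA \<sigma>) \<phi>) = Mod U R (QA \<sigma>) \<union> Mod U R \<phi>"
      unfolding Disj_def Mod.simps(2,3)
      using Mod_subset_Omega[of U R "QA \<sigma>"] Mod_subset_Omega[of U R \<phi>] by blast
    ultimately have "Disj (QA \<sigma>) \<phi> \<in> L_PC" "Mod U R (Disj (QA \<sigma>) \<phi>) = insert \<sigma> A"
      using \<phi>(2) by simp_all
    then show ?case by blast
  qed
qed

lemma Mod_revise:
  fixes \<psi> \<mu> :: "('v::finite, 'b::finite) pc_formula"
  assumes "qualitative_algebra U R"
  shows "revise U R d \<psi> \<mu> \<in> L_PC"
    and "Mod U R (revise U R d \<psi> \<mu>) = {\<omega> \<in> Mod U R \<mu>.
       point_dist d (Mod U R \<psi>) \<omega> = set_dist d (Mod U R \<psi>) (Mod U R \<mu>)}"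
proof -
  let ?S = "{\<omega> \<in> Mod U R \<mu>.
    point_dist d (Mod U R \<psi>) \<omega> = set_dist d (Mod U R \<psi>) (Mod U R \<mu>)}"
  have "?S \<subseteq> Omega U R" using Mod_subset_Omega by blast
  then have "\<exists>\<phi>. \<phi> \<in> L_PC \<and> Mod U R \<phi> = ?S" using ex_Mod_eq[OF assms] by blast
  then have "revise U R d \<psi> \<mu> \<in> L_PC \<and> Mod U R (revise U R d \<psi> \<mu>) = ?S"
    unfolding revise_def by (rule someI_ex)
  then show "revise U R d \<psi> \<mu> \<in> L_PC" "Mod U R (revise U R d \<psi> \<mu>) = ?S"
    by (rule conjunct1, rule conjunct2)
qed

end

theory Submission
  imports Defs
begin

text \<open>
  All minima range over finite sets, so they are infima in the extended reals, also when the set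
  is empty. Hence distances to a union are minima of distances. If \<open>\<omega>\<close> is a model of \<open>\<mu>\<^sub>j\<close> and \<open>i\<close>
  attains the minimum in \<open>d(Mod(\<psi>), \<omega>) = min\<^sub>i d(Mod(\<psi>\<^sub>i), \<omega>)\<close>, then
  \<open>\<Delta> \<le> \<Delta>\<^sub>i\<^sub>j \<le> d(Mod(\<psi>\<^sub>i), \<omega>) = d(Mod(\<psi>), \<omega>)\<close>, and the chain collapses when the right-hand side is \<open>\<Delta>\<close>.
\<close>

text \<open>De Morgan inside \<open>Omega\<close>; the double complement cancels because model sets
  lie in \<open>Omega\<close>.\<close>

lemma Mod_Disj: "Mod U R (Disj \<phi>\<^sub>1 \<phi>\<^sub>2) = Mod U R \<phi>\<^sub>1 \<union> Mod U R \<phi>\<^sub>2"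
  using Mod_subset_Omega[of U R \<phi>\<^sub>1] Mod_subset_Omega[of U R \<phi>\<^sub>2] by (auto simp: Disj_def)

lemma Mod_Disjs: "Mod U R (Disjs \<phi>s) = (\<Union>\<phi>\<in>set \<phi>s. Mod U R \<phi>)"
proof (induction \<phi>s rule: Disjs.induct)
  \<comment> \<open>No interpretation satisfies a constraint with the empty relation, whereas every
    member of \<open>Omega\<close> is satisfied by some interpretation, so none entails the empty
    disjunction.\<close>
  case 1
  show ?case
    by (auto simp: Omega_def consistent_def qa_entails_def satisfies_def satisfies_constraint_def)
qed (simp_all add: Mod_Disj)

text \<open>The value \<open>\<infinity>\<close> on the empty set agrees with
  \<open>Inf {} = top\<close> in \<open>ereal\<close>.\<close>

lemma min_dist_eq_Inf: "finite S \<Longrightarrow> min_dist S = Inf S"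
  by (simp add: min_dist_def Min_Inf top_ereal_def)

text \<open>A general \<open>f\<close> serves two purposes: distances as functions of a point, and,
  with \<open>f\<close> the identity, unions of sets of values.\<close>

lemma INF_UNION:
  fixes f :: "'a \<Rightarrow> 'b::complete_lattice"
  shows "(INF x\<in>(\<Union>i\<in>I. A i). f x) = (INF i\<in>I. INF x\<in>A i. f x)"
  by (intro order.antisym INF_greatest) (auto intro: INF_lower INF_lower2)

lemma point_dist_eq_INF:
  assumes "finite A"
  shows "point_dist d A \<omega> = (INF \<alpha>\<in>A. ereal (d \<alpha> \<omega>))"
  unfolding point_dist_def Setcompr_eq_image using assms by (simp add: min_dist_eq_Inf)

text \<open>Pairs are grouped by their second component. If \<open>A\<close> or \<open>B\<close> is
  empty, both sides are \<open>\<infinity>\<close>.\<close>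

lemma set_dist_eq_INF:
  assumes "finite A" "finite B"
  shows "set_dist d A B = (INF \<beta>\<in>B. point_dist d A \<beta>)"
proof -
  have eq: "{ereal (d \<alpha> \<beta>) | \<alpha> \<beta>. \<alpha> \<in> A \<and> \<beta> \<in> B} = (\<Union>\<beta>\<in>B. (\<lambda>\<alpha>. ereal (d \<alpha> \<beta>)) ` A)"
    by blast
  have "set_dist d A B = Inf (\<Union>\<beta>\<in>B. (\<lambda>\<alpha>. ereal (d \<alpha> \<beta>)) ` A)"
    unfolding set_dist_def eq using assms by (intro min_dist_eq_Inf) auto
  also have "\<dots> = (INF \<beta>\<in>B. INF \<alpha>\<in>A. ereal (d \<alpha> \<beta>))"
    by (rule INF_UNION[where f = "\<lambda>x. x", simplified])
  finally show ?thesis using assms by (simp add: point_dist_eq_INF)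
qed

lemma set_dist_le_point_dist:
  assumes "finite A" "finite B" "\<omega> \<in> B"
  shows "set_dist d A B \<le> point_dist d A \<omega>"
  using assms by (simp add: set_dist_eq_INF INF_lower)

lemma point_dist_UN:
  assumes "finite I" "\<And>i. i \<in> I \<Longrightarrow> finite (A i)"
  shows "point_dist d (\<Union>i\<in>I. A i) \<omega> = (INF i\<in>I. point_dist d (A i) \<omega>)"
  using assms by (simp add: point_dist_eq_INF INF_UNION)

lemma set_dist_UN:
  assumes "finite I" "\<And>i. i \<in> I \<Longrightarrow> finite (A i)" "finite J" "\<And>j. j \<in> J \<Longrightarrow> finite (B j)"
  shows "set_dist d (\<Union>i\<in>I. A i) (\<Union>j\<in>J. B j) = (INF i\<in>I. INF j\<in>J. set_dist d (A i) (B j))"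
proof -
  have "set_dist d (\<Union>i\<in>I. A i) (\<Union>j\<in>J. B j)
      = (INF j\<in>J. INF \<beta>\<in>B j. INF i\<in>I. point_dist d (A i) \<beta>)"
    using assms by (simp add: set_dist_eq_INF point_dist_UN INF_UNION)
  also have "\<dots> = (INF i\<in>I. INF j\<in>J. INF \<beta>\<in>B j. point_dist d (A i) \<beta>)"
    \<comment> \<open>The index \<open>i\<close> is exchanged with \<open>\<beta>\<close> and with
      \<open>j\<close> separately; since \<open>B j\<close> depends on \<open>j\<close>,
      \<open>\<beta>\<close> must stay inside \<open>j\<close>.\<close>
    by (subst (2) INF_commute, subst INF_commute) (rule refl)
  finally show ?thesis using assms by (simp add: set_dist_eq_INF)
qed

text \<open>This is the revision identity with formulas replaced by their model sets.\<close>

lemma nearest_points_UN: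
  assumes I: "finite I" "I \<noteq> {}" "\<And>i. i \<in> I \<Longrightarrow> finite (A i)"
    and J: "finite J" "\<And>j. j \<in> J \<Longrightarrow> finite (B j)"
    and \<Delta>: "\<Delta> = set_dist d (\<Union>i\<in>I. A i) (\<Union>j\<in>J. B j)"
  shows "{\<omega> \<in> \<Union>j\<in>J. B j. point_dist d (\<Union>i\<in>I. A i) \<omega> = \<Delta>}
    = (\<Union>(i, j) \<in> {(i, j) \<in> I \<times> J. set_dist d (A i) (B j) = \<Delta>}.
        {\<omega> \<in> B j. point_dist d (A i) \<omega> = set_dist d (A i) (B j)})" (is "?L = ?R")
proof -
  have UN: "point_dist d (\<Union>i\<in>I. A i) \<omega> = (INF i\<in>I. point_dist d (A i) \<omega>)"
    "set_dist d (\<Union>i\<in>I. A i) (\<Union>j\<in>J. B j) = (INF i\<in>I. INF j\<in>J. set_dist d (A i) (B j))" for \<omega>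
    using I J by (simp_all add: point_dist_UN set_dist_UN)
  show ?thesis
  proof (intro equalityI subsetI)
    fix \<omega> assume "\<omega> \<in> ?L"
    then obtain j where j: "j \<in> J" "\<omega> \<in> B j" and \<omega>: "point_dist d (\<Union>i\<in>I. A i) \<omega> = \<Delta>"
      by blast
    \<comment> \<open>A finite nonempty set contains its infimum; this yields an \<open>i\<close>
      whose \<open>A i\<close> is nearest to \<omega>.\<close>
    have "(INF i\<in>I. point_dist d (A i) \<omega>) \<in> (\<lambda>i. point_dist d (A i) \<omega>) ` I"
      using Min_in[of "(\<lambda>i. point_dist d (A i) \<omega>) ` I"] I by (simp add: Min_Inf)
    then obtain i where "i \<in> I" "(INF i\<in>I. point_dist d (A i) \<omega>) = point_dist d (A i) \<omega>"
      by blast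
    then have i: "i \<in> I" "point_dist d (A i) \<omega> = \<Delta>"
      using \<omega> by (simp_all add: UN(1))
    have "\<Delta> \<le> set_dist d (A i) (B j)"
      unfolding \<Delta> UN(2) by (intro INF_lower2[OF i(1)] INF_lower2[OF j(1)] order.refl)
    moreover have "set_dist d (A i) (B j) \<le> \<Delta>"
      using set_dist_le_point_dist[of "A i" "B j" \<omega> d] I J i j by simp
    ultimately have "set_dist d (A i) (B j) = \<Delta>" by simp
    then have "(i, j) \<in> {(i, j) \<in> I \<times> J. set_dist d (A i) (B j) = \<Delta>}"
        "point_dist d (A i) \<omega> = set_dist d (A i) (B j)"
      using i j by simp_all
    then show "\<omega> \<in> ?R" using j(2) by blast
  next
    fix \<omega> assume "\<omega> \<in> ?R"
    then obtain i j where ij: "i \<in> I" "j \<in> J" "\<omega> \<in> B j" "point_dist d (A i) \<omega> = \<Delta>"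
      by auto
    \<comment> \<open>The single index \<open>i\<close> bounds the infimum from above; membership of
      \<omega> in the union of the \<open>B j\<close> bounds it from below.\<close>
    then have "point_dist d (\<Union>i\<in>I. A i) \<omega> \<le> \<Delta>"
      unfolding UN(1) by (intro INF_lower2[of i]) simp_all
    moreover have "\<Delta> \<le> point_dist d (\<Union>i\<in>I. A i) \<omega>"
      unfolding \<Delta> using I J ij by (intro set_dist_le_point_dist) auto
    ultimately have "point_dist d (\<Union>i\<in>I. A i) \<omega> = \<Delta>" by (rule order.antisym)
    then show "\<omega> \<in> ?L" using ij by blast
  qed
qed

theorem proposition3:
  fixes U :: "'d set set"
    and R :: "'b::finite \<Rightarrow> 'd set rel"
    and d :: "('v::finite, 'b) qa_formula \<Rightarrow> ('v, 'b) qa_formula \<Rightarrow> real"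
    and \<psi> \<mu> :: "('v, 'b) pc_formula"
    and \<psi>s \<mu>s :: "nat \<Rightarrow> ('v, 'b) pc_formula"
    and n m :: nat
    and \<Delta>s :: "nat \<Rightarrow> nat \<Rightarrow> ereal"
    and \<Delta> :: ereal
  assumes "qualitative_algebra U R"
    and "Metric_space (Omega U R) d"
    and "\<psi> \<in> L_PC" and "\<mu> \<in> L_PC"
    and "n \<ge> 1" and "m \<ge> 1"
    and "\<And>i. i < n \<Longrightarrow> \<psi>s i \<in> L_PC"
    and "\<And>j. j < m \<Longrightarrow> \<mu>s j \<in> L_PC"
    and "\<psi> = Disjs [\<psi>s i. i \<leftarrow> [0..<n]]"
    and "\<mu> = Disjs [\<mu>s j. j \<leftarrow> [0..<m]]"
    and "\<And>i j. i < n \<Longrightarrow> j < m \<Longrightarrow> \<Delta>s i j = set_dist d (Mod U R (\<psi>s i)) (Mod U R (\<mu>s j))"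
    and "\<Delta> = set_dist d (Mod U R \<psi>) (Mod U R \<mu>)"
  shows "pc_equiv U R (revise U R d \<psi> \<mu>)
           (Disjs [revise U R d (\<psi>s i) (\<mu>s j). i \<leftarrow> [0..<n], j \<leftarrow> [0..<m], \<Delta>s i j = \<Delta>])
         \<and> \<Delta> = Min {\<Delta>s i j | i j. i < n \<and> j < m}"
proof
  have fin: "finite (Mod U R \<phi>)" for \<phi> :: "('v, 'b) pc_formula"
    using Mod_subset_Omega finite_Omega by (rule finite_subset)
  have \<psi>: "Mod U R \<psi> = (\<Union>i\<in>{..<n}. Mod U R (\<psi>s i))"
    by (simp add: assms(9) Mod_Disjs atLeast0LessThan)
  have \<mu>: "Mod U R \<mu> = (\<Union>j\<in>{..<m}. Mod U R (\<mu>s j))"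
    by (simp add: assms(10) Mod_Disjs atLeast0LessThan)
  note revise = Mod_revise(2)[OF assms(1)]
  have "Mod U R (revise U R d \<psi> \<mu>)
      = (\<Union>(i, j) \<in> {(i, j) \<in> {..<n} \<times> {..<m}.
            set_dist d (Mod U R (\<psi>s i)) (Mod U R (\<mu>s j)) = \<Delta>}.
          Mod U R (revise U R d (\<psi>s i) (\<mu>s j)))"
    \<comment> \<open>The distance is folded into \<Delta> before \<psi> and \<mu> are expanded, so
      that the goal matches \<open>nearest_points_UN\<close>.\<close>
    unfolding revise assms(12)[symmetric] unfolding \<psi> \<mu>
    by (rule nearest_points_UN) (use assms(5,12) fin in \<open>auto simp: \<psi> \<mu> lessThan_empty_iff\<close>)
  also have "\<dots> = Mod U R
      (Disjs [revise U R d (\<psi>s i) (\<mu>s j). i \<leftarrow> [0..<n], j \<leftarrow> [0..<m], \<Delta>s i j = \<Delta>])"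
    \<comment> \<open>For indices in range, the filter \<open>\<Delta>s i j = \<Delta>\<close>
      selects the same pairs as the condition on \<open>set_dist\<close>.\<close>
    unfolding Mod_Disjs using assms(11) by fastforce
  finally show "pc_equiv U R (revise U R d \<psi> \<mu>)
      (Disjs [revise U R d (\<psi>s i) (\<mu>s j). i \<leftarrow> [0..<n], j \<leftarrow> [0..<m], \<Delta>s i j = \<Delta>])"
    unfolding pc_equiv_def .
  have \<Delta>s: "{\<Delta>s i j | i j. i < n \<and> j < m} = (\<Union>i\<in>{..<n}. \<Delta>s i ` {..<m})"
    by blast
  have "\<Delta> = (INF i\<in>{..<n}. INF j\<in>{..<m}. \<Delta>s i j)"
    using fin by (simp add: assms(11,12) \<psi> \<mu> set_dist_UN)
  also have "\<dots> = Inf (\<Union>i\<in>{..<n}. \<Delta>s i ` {..<m})"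
    by (rule INF_UNION[where f = "\<lambda>x. x", simplified, symmetric])
  also have "\<dots> = Min {\<Delta>s i j | i j. i < n \<and> j < m}"
    \<comment> \<open>Index 0 is in range for both families, so the finite set of values is nonempty
      and its infimum is a minimum.\<close>
    unfolding \<Delta>s using assms(5,6) by (intro Min_Inf[symmetric]) (auto simp: lessThan_empty_iff intro: exI[of _ 0])
  finally show "\<Delta> = Min {\<Delta>s i j | i j. i < n \<and> j < m}" .
qed

end
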